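(* Let $D$ be an integral domain of (Krull) dimension $1$, and let $\Theta:=\{D_M\mid M\in\mathrm{Max}(D)\}$. Then $\Theta$ is a pre-Jaffard family of $D$.
   Context: "Compact" means quasi-compact. Let $K$ be the quotient field of $D$. An overring of $D$ is a ring $T$ with $D\subseteq T\subseteq K$; $\mathrm{Over}(D)$ is the set of overrings. The Zariski topology on $\mathrm{Over}(D)$ has as subbasis of open sets the sets $\mathcal B(x_1,\dots,x_n)=\{T\mid x_1,\dots,x_n\in T\}$, $x_i\in K$. For an overring $T$ put $\sigma(T)=\{Q\cap D\mid Q\in\mathrm{Spec}(T)\}$. A family $\Theta$ of overrings is complete if $I=\bigcap\{IT\mid T\in\Theta\}$ for every ideal $I$ of $D$, and independent if $\sigma(A)\cap\sigma(B)=\{(0)\}$ for all distinct $A,B\in\Theta$. $\Theta$ is a pre-Jaffard family of $D$ if: either $K\notin\Theta$ or $\Theta=\{K\}$; every $T\in\Theta$ is flat as a $D$-module; $\Theta$ is complete, independent, and compact in the Zariski topology. *)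

theory Defs
  imports
    "HOL-Algebra.Ideal"
    "HOL-Algebra.Module"
    "HOL-Algebra.Subrings"
    "HOL-Algebra.Free_Abelian_Groups"
    "HOL-Algebra.Generated_Groups"
    "HOL-Analysis.Abstract_Topology"
    "HOL-Library.Extended_Nat"
begin

text \<open>
  Throughout, an integral domain \<open>D\<close> is a subset of its quotient field \<open>K\<close>; a subring \<open>T\<close> of \<open>K\<close>
  is given by its carrier set, and the ring itself is \<open>K\<lparr>carrier := T\<rparr>\<close>.
\<close>

definition is_quotient_field :: "('a, 'b) ring_scheme \<Rightarrow> 'a set \<Rightarrow> bool" where
  "is_quotient_field K D \<longleftrightarrow>
     field K \<and> subdomain D K \<and>
     (\<forall>x\<in>carrier K. \<exists>a\<in>D. \<exists>b\<in>D - {\<zero>\<^bsub>K\<^esub>}. x = a \<otimes>\<^bsub>K\<^esub> inv\<^bsub>K\<^esub> b)"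

definition spectrum :: "('a, 'b) ring_scheme \<Rightarrow> 'a set set" where
  "spectrum R = {P. primeideal P R}"

definition max_spectrum :: "('a, 'b) ring_scheme \<Rightarrow> 'a set set" where
  "max_spectrum R = {M. maximalideal M R}"

text \<open>
  The supremum of the lengths \<open>n\<close> of chains \<open>P 0 \<subset> \<dots> \<subset> P n\<close> of prime ideals.
  By this definition the zero ring has dimension \<open>0\<close>, the supremum of the empty set.
\<close>

definition krull_dim :: "('a, 'b) ring_scheme \<Rightarrow> enat" where
  "krull_dim R =
     Sup {enat n | n. \<exists>P :: nat \<Rightarrow> 'a set.
            (\<forall>i\<le>n. P i \<in> spectrum R) \<and> (\<forall>i<n. P i \<subset> P (Suc i))}"

definition localization_at :: "('a, 'b) ring_scheme \<Rightarrow> 'a set \<Rightarrow> 'a set \<Rightarrow> 'a set" where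
  "localization_at K D P = {a \<otimes>\<^bsub>K\<^esub> inv\<^bsub>K\<^esub> s | a s. a \<in> D \<and> s \<in> D - P}"


section \<open>Tensor products and flatness\<close>

definition module_hom_set ::
  "('r, 'x) ring_scheme \<Rightarrow> ('r, 'm) module \<Rightarrow> ('r, 'n) module \<Rightarrow> ('m \<Rightarrow> 'n) set" where
  "module_hom_set R M N =
     {f. f \<in> carrier M \<rightarrow> carrier N \<and>
         (\<forall>x\<in>carrier M. \<forall>y\<in>carrier M. f (x \<oplus>\<^bsub>M\<^esub> y) = f x \<oplus>\<^bsub>N\<^esub> f y) \<and>
         (\<forall>r\<in>carrier R. \<forall>x\<in>carrier M. f (r \<odot>\<^bsub>M\<^esub> x) = r \<odot>\<^bsub>N\<^esub> f x)}"

text \<open>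
  \<open>M \<otimes>\<^sub>R T\<close> as an abelian group: the free abelian group on \<open>M \<times> T\<close> (formal integer combinations,
  with \<^const>\<open>frag_of\<close> the basis elements) modulo the bilinearity relations.
\<close>

definition tensor_relators ::
  "('r, 'x) ring_scheme \<Rightarrow> ('r, 'm) module \<Rightarrow> ('r, 't) module \<Rightarrow> ('m \<times> 't \<Rightarrow>\<^sub>0 int) set" where
  "tensor_relators R M T =
     {frag_of (x \<oplus>\<^bsub>M\<^esub> y, t) - frag_of (x, t) - frag_of (y, t) | x y t.
        x \<in> carrier M \<and> y \<in> carrier M \<and> t \<in> carrier T} \<union>
     {frag_of (x, t \<oplus>\<^bsub>T\<^esub> u) - frag_of (x, t) - frag_of (x, u) | x t u.
        x \<in> carrier M \<and> t \<in> carrier T \<and> u \<in> carrier T} \<union>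
     {frag_of (r \<odot>\<^bsub>M\<^esub> x, t) - frag_of (x, r \<odot>\<^bsub>T\<^esub> t) | r x t.
        r \<in> carrier R \<and> x \<in> carrier M \<and> t \<in> carrier T}"

definition tensor_free ::
  "('r, 'm) module \<Rightarrow> ('r, 't) module \<Rightarrow> ('m \<times> 't \<Rightarrow>\<^sub>0 int) monoid" where
  "tensor_free M T = free_Abelian_group (carrier M \<times> carrier T)"

definition tensor_null ::
  "('r, 'x) ring_scheme \<Rightarrow> ('r, 'm) module \<Rightarrow> ('r, 't) module \<Rightarrow> ('m \<times> 't \<Rightarrow>\<^sub>0 int) set" where
  "tensor_null R M T = generate (tensor_free M T) (tensor_relators R M T)"

definition tensor_product ::
  "('r, 'x) ring_scheme \<Rightarrow> ('r, 'm) module \<Rightarrow> ('r, 't) module \<Rightarrow> ('m \<times> 't \<Rightarrow>\<^sub>0 int) set monoid" where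
  "tensor_product R M T = tensor_free M T Mod tensor_null R M T"

text \<open>
  The map \<open>f \<otimes> id : M \<otimes>\<^sub>R T \<rightarrow> N \<otimes>\<^sub>R T\<close>, sending the coset of \<open>z\<close> to the coset of the image of \<open>z\<close>
  under \<open>(x, t) \<mapsto> (f x, t)\<close>. All elements of the coset \<open>C\<close> yield the same coset, so the union is
  over equal sets.
\<close>

definition tensor_map ::
  "('r, 'x) ring_scheme \<Rightarrow> ('r, 'n) module \<Rightarrow> ('r, 't) module \<Rightarrow> ('m \<Rightarrow> 'n) \<Rightarrow>
   ('m \<times> 't \<Rightarrow>\<^sub>0 int) set \<Rightarrow> ('n \<times> 't \<Rightarrow>\<^sub>0 int) set" where
  "tensor_map R N T f C =
     (\<Union>z\<in>C. tensor_null R N T #>\<^bsub>tensor_free N T\<^esub>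
        frag_extend (\<lambda>(x, t). frag_of (f x, t)) z)"

text \<open>
  \<open>T\<close> is flat if \<open>- \<otimes>\<^sub>R T\<close> preserves injectivity of linear maps. A definition in HOL cannot quantify
  over types, so the types \<open>'m\<close> and \<open>'n\<close> of the elements of the test modules are parameters.
  Flatness in the usual sense is the validity of this predicate for all \<open>'m\<close> and \<open>'n\<close>, which is what
  a theorem with these type variables free in its conclusion asserts.
\<close>

definition flat_module ::
  "'m itself \<Rightarrow> 'n itself \<Rightarrow> ('r, 'x) ring_scheme \<Rightarrow> ('r, 't) module \<Rightarrow> bool" where
  "flat_module _ _ R T \<longleftrightarrow>
     Module.module R T \<and>
     (\<forall>(M :: ('r, 'm) module) (N :: ('r, 'n) module) f.
        Module.module R M \<and> Module.module R N \<and> f \<in> module_hom_set R M N \<and> inj_on f (carrier M) \<longrightarrow>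
        inj_on (tensor_map R N T f) (carrier (tensor_product R M T)))"

text \<open>
  A subring \<open>T\<close> of \<open>K\<close> as a module over its subrings. The ring multiplication and unit are unused
  fields that the record type of modules inherits.
\<close>

definition subring_module :: "('a, 'b) ring_scheme \<Rightarrow> 'a set \<Rightarrow> ('a, 'a) module" where
  "subring_module K T =
     \<lparr>carrier = T, monoid.mult = (\<otimes>\<^bsub>K\<^esub>), one = \<one>\<^bsub>K\<^esub>, ring.zero = \<zero>\<^bsub>K\<^esub>, ring.add = (\<oplus>\<^bsub>K\<^esub>),
      smult = (\<otimes>\<^bsub>K\<^esub>)\<rparr>"


section \<open>Families of overrings\<close>

definition overrings :: "('a, 'b) ring_scheme \<Rightarrow> 'a set \<Rightarrow> 'a set set" where
  "overrings K D = {T. subring T K \<and> D \<subseteq> T}"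

definition zariski_topology :: "('a, 'b) ring_scheme \<Rightarrow> 'a set \<Rightarrow> 'a set topology" where
  "zariski_topology K D =
     topology_generated_by {{T \<in> overrings K D. F \<subseteq> T} | F. finite F \<and> F \<subseteq> carrier K}"

definition sigma_spec :: "('a, 'b) ring_scheme \<Rightarrow> 'a set \<Rightarrow> 'a set \<Rightarrow> 'a set set" where
  "sigma_spec K D T = {Q \<inter> D | Q. Q \<in> spectrum (K\<lparr>carrier := T\<rparr>)}"

text \<open>The extension \<open>IT\<close> is the ideal of \<open>T\<close> generated by \<open>I\<close>.\<close>

definition complete_family :: "('a, 'b) ring_scheme \<Rightarrow> 'a set \<Rightarrow> 'a set set \<Rightarrow> bool" where
  "complete_family K D \<Theta> \<longleftrightarrow>
     (\<forall>I. ideal I (K\<lparr>carrier := D\<rparr>) \<longrightarrow> I = (\<Inter>T\<in>\<Theta>. Idl\<^bsub>K\<lparr>carrier := T\<rparr>\<^esub> I))"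

definition independent_family :: "('a, 'b) ring_scheme \<Rightarrow> 'a set \<Rightarrow> 'a set set \<Rightarrow> bool" where
  "independent_family K D \<Theta> \<longleftrightarrow>
     (\<forall>A\<in>\<Theta>. \<forall>B\<in>\<Theta>. A \<noteq> B \<longrightarrow> sigma_spec K D A \<inter> sigma_spec K D B = {{\<zero>\<^bsub>K\<^esub>}})"

text \<open>The types \<open>'m\<close> and \<open>'n\<close> only serve the flatness condition, see \<^const>\<open>flat_module\<close>.\<close>

definition pre_jaffard_family ::
  "'m itself \<Rightarrow> 'n itself \<Rightarrow> ('a, 'b) ring_scheme \<Rightarrow> 'a set \<Rightarrow> 'a set set \<Rightarrow> bool" where
  "pre_jaffard_family TM TN K D \<Theta> \<longleftrightarrow>
     \<Theta> \<subseteq> overrings K D \<and>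
     (carrier K \<notin> \<Theta> \<or> \<Theta> = {carrier K}) \<and>
     (\<forall>T\<in>\<Theta>. flat_module TM TN (K\<lparr>carrier := D\<rparr>) (subring_module K T)) \<and>
     complete_family K D \<Theta> \<and>
     independent_family K D \<Theta> \<and>
     compactin (zariski_topology K D) \<Theta>"

end

theory Submission
  imports Defs
begin

text \<open>
  A finite set of elements of \<open>D\<^sub>M\<close> has a common denominator, so every element of \<open>N \<otimes> D\<^sub>M\<close> is of
  the form \<open>x \<otimes> (1/s)\<close>, and it vanishes iff \<open>u x = 0\<close> for some \<open>u \<in> D - M\<close>; flatness follows.
  Completeness and compactness both use that an ideal of \<open>D\<close> contained in no maximal ideal contains
  \<open>1\<close>: for completeness the ideal is \<open>{d. d x \<in> I}\<close>, and for compactness it consists of the \<open>d\<close> such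
  that finitely many members of the given cover contain all \<open>D\<^sub>N\<close> with \<open>d \<notin> N\<close>. The prime ideals
  in \<open>\<sigma>(D\<^sub>M)\<close> lie in \<open>M\<close>, and in dimension \<open>1\<close> a nonzero prime ideal is maximal, hence equal to \<open>M\<close>
  if it lies in \<open>M\<close>; this gives independence.
\<close>

section \<open>Tensor products\<close>

lemma tensor_relators_subset:
  assumes "Module.module R M" "Module.module R T"
  shows "tensor_relators R M T \<subseteq> carrier (tensor_free M T)"
proof -
  interpret M: Module.module R M by fact
  interpret T: Module.module R T by fact
  show ?thesis
    unfolding tensor_relators_def tensor_free_def
    by (auto simp del: Poly_Mapping.keys_single simp: keys_frag_of dest!: subsetD[OF keys_diff])
qed

lemma subgroup_tensor_null:
  assumes "Module.module R M" "Module.module R T"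
  shows "subgroup (tensor_null R M T) (tensor_free M T)"
  unfolding tensor_null_def
  by (rule group.generate_is_subgroup)
    (use tensor_relators_subset[OF assms] in \<open>auto simp: tensor_free_def\<close>)

context
  fixes R :: "('r, 'x) ring_scheme" and M :: "('r, 'm) module" and T :: "('r, 't) module"
  assumes M: "Module.module R M" and T: "Module.module R T"
begin

lemma tensor_null_keys:
  "z \<in> tensor_null R M T \<Longrightarrow> Poly_Mapping.keys z \<subseteq> carrier M \<times> carrier T"
  using subsetD[OF subgroup.subset[OF subgroup_tensor_null[OF M T]]] by (simp add: tensor_free_def)

lemma tensor_null_zero: "0 \<in> tensor_null R M T"
  using subgroup.one_closed[OF subgroup_tensor_null[OF M T]] by (simp add: tensor_free_def)

lemma tensor_null_add:
  "y \<in> tensor_null R M T \<Longrightarrow> z \<in> tensor_null R M T \<Longrightarrow> y + z \<in> tensor_null R M T"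
  using subgroup.m_closed[OF subgroup_tensor_null[OF M T]] by (simp add: tensor_free_def)

lemma tensor_null_uminus: "z \<in> tensor_null R M T \<Longrightarrow> - z \<in> tensor_null R M T"
  using subgroup.m_inv_closed[OF subgroup_tensor_null[OF M T]] tensor_null_keys
  by (simp add: tensor_free_def)

lemma tensor_null_diff:
  "y \<in> tensor_null R M T \<Longrightarrow> z \<in> tensor_null R M T \<Longrightarrow> y - z \<in> tensor_null R M T"
  using tensor_null_add[OF _ tensor_null_uminus, of y z] by simp

lemma tensor_null_bilinear:
  shows "x \<in> carrier M \<Longrightarrow> y \<in> carrier M \<Longrightarrow> t \<in> carrier T \<Longrightarrow>
      frag_of (x \<oplus>\<^bsub>M\<^esub> y, t) - frag_of (x, t) - frag_of (y, t) \<in> tensor_null R M T"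
    and "x \<in> carrier M \<Longrightarrow> t \<in> carrier T \<Longrightarrow> u \<in> carrier T \<Longrightarrow>
      frag_of (x, t \<oplus>\<^bsub>T\<^esub> u) - frag_of (x, t) - frag_of (x, u) \<in> tensor_null R M T"
    and "r \<in> carrier R \<Longrightarrow> x \<in> carrier M \<Longrightarrow> t \<in> carrier T \<Longrightarrow>
      frag_of (r \<odot>\<^bsub>M\<^esub> x, t) - frag_of (x, r \<odot>\<^bsub>T\<^esub> t) \<in> tensor_null R M T"
  unfolding tensor_null_def tensor_relators_def by (rule generate.incl; blast)+

lemma tensor_null_frag_of_zero:
  assumes "t \<in> carrier T"
  shows "frag_of (\<zero>\<^bsub>M\<^esub>, t) \<in> tensor_null R M T"
proof -
  interpret M: Module.module R M by (rule M)
  \<comment> \<open>The additivity relation for two zeros collapses to minus the wanted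
    element.\<close>
  have "- frag_of (\<zero>\<^bsub>M\<^esub>, t) \<in> tensor_null R M T"
    using tensor_null_bilinear(1)[of "\<zero>\<^bsub>M\<^esub>" "\<zero>\<^bsub>M\<^esub>" t] assms by simp
  then show ?thesis
    using tensor_null_uminus by fastforce
qed

text \<open>Serves as an induction rule for null combinations: the combinations with a given
  property are taken as \<open>H\<close>, and only the subgroup property and the three kinds of
  relators remain to be checked.\<close>

lemma tensor_null_subset:
  assumes "subgroup H (tensor_free M T)"
    and "\<And>x y t. x \<in> carrier M \<Longrightarrow> y \<in> carrier M \<Longrightarrow> t \<in> carrier T \<Longrightarrow>
      frag_of (x \<oplus>\<^bsub>M\<^esub> y, t) - frag_of (x, t) - frag_of (y, t) \<in> H"
    and "\<And>x t u. x \<in> carrier M \<Longrightarrow> t \<in> carrier T \<Longrightarrow> u \<in> carrier T \<Longrightarrow>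
      frag_of (x, t \<oplus>\<^bsub>T\<^esub> u) - frag_of (x, t) - frag_of (x, u) \<in> H"
    and "\<And>r x t. r \<in> carrier R \<Longrightarrow> x \<in> carrier M \<Longrightarrow> t \<in> carrier T \<Longrightarrow>
      frag_of (r \<odot>\<^bsub>M\<^esub> x, t) - frag_of (x, r \<odot>\<^bsub>T\<^esub> t) \<in> H"
  shows "tensor_null R M T \<subseteq> H"
  unfolding tensor_null_def
proof (rule group.generate_subgroup_incl)
  show "group (tensor_free M T)"
    by (simp add: tensor_free_def)
  show "tensor_relators R M T \<subseteq> H"
    unfolding tensor_relators_def using assms(2-4) by blast
qed fact

end

text \<open>This makes \<open>f\<close> tensored with the identity well defined: by linearity of
  \<open>f\<close> each relator over \<open>M\<close> goes to a relator over \<open>N\<close>, and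
  the preimage of a subgroup is a subgroup.\<close>

lemma frag_extend_tensor_null:
  assumes M: "Module.module R M" and N: "Module.module R N" and T: "Module.module R T"
    and f: "f \<in> module_hom_set R M N"
    and z: "z \<in> tensor_null R M T"
  shows "frag_extend (\<lambda>(x, t). frag_of (f x, t)) z \<in> tensor_null R N T"
proof -
  interpret M: Module.module R M by (rule M)
  interpret T: Module.module R T by (rule T)
  let ?F = "frag_extend (\<lambda>(x, t). frag_of (f x, t))"
  \<comment> \<open>The support condition keeps \<open>?H\<close> inside the free abelian group on
    pairs.\<close>
  let ?H = "{z. Poly_Mapping.keys z \<subseteq> carrier M \<times> carrier T \<and> ?F z \<in> tensor_null R N T}"
  have "tensor_null R M T \<subseteq> ?H"
  proof (rule tensor_null_subset[OF M T])
    show "subgroup ?H (tensor_free M T)"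
      unfolding tensor_free_def
      by (rule group.subgroupI)
        (use tensor_null_zero[OF N T] in \<open>auto simp: frag_extend_add frag_extend_minus
          intro: tensor_null_add[OF N T] tensor_null_uminus[OF N T] exI[of _ 0]
          dest!: subsetD[OF keys_add]\<close>)
  qed (use f in \<open>auto simp: module_hom_set_def frag_extend_diff keys_frag_of Pi_iff
          intro!: tensor_null_bilinear[OF N T] dest!: subsetD[OF keys_diff]\<close>)
  then show ?thesis
    using z by blast
qed

text \<open>Reduces injectivity on cosets to a kernel condition on formal combinations, so that the
  flatness argument can work with representatives.\<close>

lemma inj_on_tensor_map:
  fixes M :: "('r, 'm) module" and N :: "('r, 'n) module" and T :: "('r, 't) module"
  assumes M: "Module.module R M" and N: "Module.module R N" and T: "Module.module R T"
    and f: "f \<in> module_hom_set R M N"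
    and kernel: "\<And>z. Poly_Mapping.keys z \<subseteq> carrier M \<times> carrier T \<Longrightarrow>
      frag_extend (\<lambda>(x, t). frag_of (f x, t)) z \<in> tensor_null R N T \<Longrightarrow> z \<in> tensor_null R M T"
  shows "inj_on (tensor_map R N T f) (carrier (tensor_product R M T))"
proof (rule inj_onI)
  let ?F = "frag_extend (\<lambda>(x, t). frag_of (f x, t))"
  interpret G: group "tensor_free M T" by (simp add: tensor_free_def)
  interpret H: subgroup "tensor_null R M T" "tensor_free M T"
    by (rule subgroup_tensor_null[OF M T])
  fix C C'
  assume "C \<in> carrier (tensor_product R M T)" "C' \<in> carrier (tensor_product R M T)"
    and eq: "tensor_map R N T f C = tensor_map R N T f C'"
  then obtain z z' where z: "z \<in> carrier (tensor_free M T)" "C = tensor_null R M T #>\<^bsub>tensor_free M T\<^esub> z"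
    and z': "z' \<in> carrier (tensor_free M T)" "C' = tensor_null R M T #>\<^bsub>tensor_free M T\<^esub> z'"
    by (auto simp: tensor_product_def carrier_FactGroup)
  have "z \<in> C"
    using z by (simp add: G.rcos_self H.subgroup_axioms)
  then have "?F z \<in> tensor_map R N T f C"
    unfolding tensor_map_def r_coset_def using tensor_null_zero[OF N T]
    by (force simp: tensor_free_def)
  \<comment> \<open>Equality of the two images yields only some representative \<open>w\<close> of
    \<open>C'\<close>, but the image of \<open>z - w\<close> is null, which is what the kernel
    condition asks for.\<close>
  then obtain w where w: "w \<in> C'" and "?F z \<in> tensor_null R N T #>\<^bsub>tensor_free N T\<^esub> ?F w"
    unfolding eq by (auto simp: tensor_map_def)
  then have "?F (z - w) \<in> tensor_null R N T"
    by (auto simp: r_coset_def tensor_free_def frag_extend_diff)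
  moreover have w_carrier: "w \<in> carrier (tensor_free M T)"
    using w z' H.elemrcos_carrier[OF G.is_group] by blast
  ultimately have "z - w \<in> tensor_null R M T"
    using z(1) by (intro kernel) (auto simp: tensor_free_def dest!: subsetD[OF keys_diff])
  then have "z \<in> tensor_null R M T #>\<^bsub>tensor_free M T\<^esub> w"
    unfolding r_coset_def by (force simp: tensor_free_def)
  then show "C = C'"
    using w w_carrier z z' G.repr_independence H.subgroup_axioms by metis
qed


section \<open>Ideals of subrings\<close>

text \<open>Zorn's lemma, with properness of an ideal expressed as avoiding \<open>\<one>\<close>, a
  condition that passes to unions of chains.\<close>

lemma (in ring) exists_maximalideal:
  assumes I: "ideal I R" and one: "\<one> \<notin> I"
  obtains M where "maximalideal M R" "I \<subseteq> M"
proof -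
  let ?A = "{J. ideal J R \<and> I \<subseteq> J \<and> \<one> \<notin> J}"
  have "\<exists>M\<in>?A. \<forall>X\<in>?A. M \<subseteq> X \<longrightarrow> X = M"
  proof (rule subset_Zorn_nonempty)
    show "?A \<noteq> {}"
      using assms by blast
    fix C assume C: "C \<noteq> {}" "subset.chain ?A C"
    then have sub: "ideal J R" "I \<subseteq> J" "\<one> \<notin> J" if "J \<in> C" for J
      using that unfolding pred_on.chain_def by blast+
    note subgroup = ideal.axioms(1)[OF sub(1)]
    obtain J\<^sub>0 where J\<^sub>0: "J\<^sub>0 \<in> C"
      using C(1) by blast
    have "ideal (\<Union>C) R"
    proof (rule idealI[OF ring_axioms add.subgroupI])
      show "\<Union>C \<subseteq> carrier R"
        using ideal.Icarr[OF sub(1)] by (intro Union_least subsetI)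
      show "\<Union>C \<noteq> {}"
        using J\<^sub>0 additive_subgroup.zero_closed[OF subgroup[OF J\<^sub>0]] by blast
      show "\<ominus> a \<in> \<Union>C" if "a \<in> \<Union>C" for a
        using that additive_subgroup.a_inv_closed[OF subgroup] by (elim UnionE) (rule UnionI)
      show "a \<oplus> b \<in> \<Union>C" if ab: "a \<in> \<Union>C" "b \<in> \<Union>C" for a b
      proof -
        from ab obtain J J' where J: "J \<in> C" "J' \<in> C" "a \<in> J" "b \<in> J'"
          by (elim UnionE)
        \<comment> \<open>Addition is where the chain condition enters: the larger of the two ideals
          contains both summands.\<close>
        then have "J \<subseteq> J' \<or> J' \<subseteq> J"
          using C(2) unfolding pred_on.chain_def by blast
        then show ?thesis
        proof
          assume "J \<subseteq> J'"
          then have "a \<oplus> b \<in> J'"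
            using additive_subgroup.a_closed[OF subgroup[OF J(2)]] J(3,4) by (simp add: subsetD)
          then show ?thesis
            using J(2) by (rule UnionI[rotated])
        next
          assume "J' \<subseteq> J"
          then have "a \<oplus> b \<in> J"
            using additive_subgroup.a_closed[OF subgroup[OF J(1)]] J(3,4) by (simp add: subsetD)
          then show ?thesis
            using J(1) by (rule UnionI[rotated])
        qed
      qed
      fix a x assume a: "a \<in> \<Union>C" and x: "x \<in> carrier R"
      then obtain J where J: "J \<in> C" "a \<in> J"
        by (elim UnionE)
      show "x \<otimes> a \<in> \<Union>C"
        by (rule UnionI[OF J(1) ideal.I_l_closed[OF sub(1)[OF J(1)] J(2) x]])
      show "a \<otimes> x \<in> \<Union>C"
        by (rule UnionI[OF J(1) ideal.I_r_closed[OF sub(1)[OF J(1)] J(2) x]])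
    qed
    moreover have "I \<subseteq> \<Union>C"
      using sub(2)[OF J\<^sub>0] J\<^sub>0 by blast
    moreover have "\<one> \<notin> \<Union>C"
      using sub(3) by blast
    ultimately show "\<Union>C \<in> ?A"
      by (intro CollectI conjI)
  qed
  then obtain M where M: "ideal M R" "I \<subseteq> M" "\<one> \<notin> M" and max: "\<forall>X\<in>?A. M \<subseteq> X \<longrightarrow> X = M"
    by (elim bexE CollectE conjE)
  have "maximalideal M R"
  proof (rule maximalidealI[OF M(1)])
    show "carrier R \<noteq> M"
      using M(3) one_closed by metis
    show "J = M \<or> J = carrier R" if J: "ideal J R" "M \<subseteq> J" for J
    proof (cases "\<one> \<in> J")
      case True
      then show ?thesis
        by (rule ideal.one_imp_carrier[OF J(1), THEN disjI2])
    next
      case False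
      then have "J \<in> ?A"
        using J M(2) by (intro CollectI conjI) simp_all
      then show ?thesis
        using max J(2) by simp
    qed
  qed
  then show thesis
    using M(2) by (rule that)
qed

section \<open>Ideals of a subring in terms of the ambient operations\<close>

context cring
begin

text \<open>Closure under negation follows, because \<open>\<ominus> a\<close> is the multiple of
  \<open>a\<close> by \<open>\<ominus> \<one>\<close>, which lies in \<open>T\<close>. Commutativity
  reduces absorption to one side.\<close>

lemma ideal_subring_iff:
  assumes "subring T R"
  shows "ideal I (R\<lparr>carrier := T\<rparr>) \<longleftrightarrow>
    I \<subseteq> T \<and> \<zero> \<in> I \<and> (\<forall>a\<in>I. \<forall>b\<in>I. a \<oplus> b \<in> I) \<and> (\<forall>r\<in>T. \<forall>a\<in>I. r \<otimes> a \<in> I)"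
    (is "?L \<longleftrightarrow> ?R")
proof
  assume ?L
  then have I: "ideal I (R\<lparr>carrier := T\<rparr>)" .
  show ?R
  proof (intro conjI ballI)
    show "I \<subseteq> T"
      using ideal.Icarr[OF I] by auto
    show "\<zero> \<in> I"
      using additive_subgroup.zero_closed[OF ideal.axioms(1)[OF I]] by simp
    show "a \<oplus> b \<in> I" if "a \<in> I" "b \<in> I" for a b
      using additive_subgroup.a_closed[OF ideal.axioms(1)[OF I] that] by simp
    show "r \<otimes> a \<in> I" if "r \<in> T" "a \<in> I" for r a
      using ideal.I_l_closed[OF I, of a r] that by simp
  qed
next
  assume "?R"
  then have IT: "I \<subseteq> T" and zero: "\<zero> \<in> I"
    and add: "\<And>a b. a \<in> I \<Longrightarrow> b \<in> I \<Longrightarrow> a \<oplus> b \<in> I"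
    and mult: "\<And>r a. r \<in> T \<Longrightarrow> a \<in> I \<Longrightarrow> r \<otimes> a \<in> I"
    by blast+
  note T = subringE[OF assms]
  have I_carrier: "a \<in> carrier R" if "a \<in> I" for a
    using that IT T(1) by blast
  have "\<ominus> a \<in> I" if "a \<in> I" for a
  proof -
    have "\<ominus> a = (\<ominus> \<one>) \<otimes> a"
      using l_minus[of \<one> a] I_carrier[OF that] by simp
    then show ?thesis
      using mult[OF T(5)[OF T(3)] that] by metis
  qed
  then have sub: "subgroup I (add_monoid R)"
    using zero add I_carrier by (intro add.subgroupI) blast+
  have "subgroup T (add_monoid R)"
    using assms by (rule subring.axioms)
  then have "subgroup I ((add_monoid R)\<lparr>carrier := T\<rparr>)"
    using add.subgroup_incl[OF sub _ IT] by blast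
  then have "subgroup I (add_monoid (R\<lparr>carrier := T\<rparr>))"
    by simp
  then show ?L
  proof (rule idealI[OF subring_is_ring[OF assms]])
    fix a x assume "a \<in> I" and x: "x \<in> carrier (R\<lparr>carrier := T\<rparr>)"
    then have xT: "x \<in> T" and a: "a \<in> I"
      by simp_all
    show "x \<otimes>\<^bsub>R\<lparr>carrier := T\<rparr>\<^esub> a \<in> I"
      using mult[OF xT a] by simp
    have "a \<otimes> x = x \<otimes> a"
      using m_comm I_carrier[OF a] T(1) xT by blast
    then show "a \<otimes>\<^bsub>R\<lparr>carrier := T\<rparr>\<^esub> x \<in> I"
      using mult[OF xT a] by simp
  qed
qed

lemma ideal_proper_subring_iff:
  assumes "subring T R" "ideal I (R\<lparr>carrier := T\<rparr>)"
  shows "T \<noteq> I \<longleftrightarrow> \<one> \<notin> I"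
proof -
  have "\<one> \<in> I \<Longrightarrow> I = T"
    using ideal.one_imp_carrier[OF assms(2)] by simp
  then show ?thesis
    using subringE(3)[OF assms(1)] by blast
qed

lemma primeideal_subring_iff:
  assumes "subring T R"
  shows "primeideal P (R\<lparr>carrier := T\<rparr>) \<longleftrightarrow>
    ideal P (R\<lparr>carrier := T\<rparr>) \<and> \<one> \<notin> P \<and> (\<forall>a\<in>T. \<forall>b\<in>T. a \<otimes> b \<in> P \<longrightarrow> a \<in> P \<or> b \<in> P)"
    (is "?L \<longleftrightarrow> ?R")
proof
  assume L: ?L
  have "T \<noteq> P"
    using primeideal.I_notcarr[OF L] by simp
  moreover have "a \<in> P \<or> b \<in> P" if "a \<in> T" "b \<in> T" "a \<otimes> b \<in> P" for a b
    using primeideal.I_prime[OF L, of a b] that by simp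
  moreover have "ideal P (R\<lparr>carrier := T\<rparr>)"
    using L by (rule primeideal.axioms)
  ultimately show ?R
    using ideal_proper_subring_iff[OF assms, of P] by blast
next
  assume R: ?R
  show ?L
  proof (rule primeidealI)
    show "cring (R\<lparr>carrier := T\<rparr>)"
      using subcring_iff[OF subringE(1)[OF assms]] subcringI'[OF assms] by (rule iffD1)
    show "carrier (R\<lparr>carrier := T\<rparr>) \<noteq> P"
      using conjunct1[OF conjunct2[OF R]] subringE(3)[OF assms] by force
    show "a \<in> P \<or> b \<in> P"
      if "a \<in> carrier (R\<lparr>carrier := T\<rparr>)" "b \<in> carrier (R\<lparr>carrier := T\<rparr>)"
        "a \<otimes>\<^bsub>R\<lparr>carrier := T\<rparr>\<^esub> b \<in> P" for a b
    proof -
      have "a \<in> T" "b \<in> T" "a \<otimes> b \<in> P"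
        using that by simp_all
      then show ?thesis
        using R by blast
    qed
    show "ideal P (R\<lparr>carrier := T\<rparr>)"
      using R by (rule conjunct1)
  qed
qed

end


section \<open>Localizations\<close>

locale field_subring = field K for K (structure) +
  fixes D :: "'a set"
  assumes subring_D: "subring D K"
begin

abbreviation R where "R \<equiv> K\<lparr>carrier := D\<rparr>"

lemmas D_closed [simp, intro] =
  subringE(2,3,5,6,7)[OF subring_D] subsetD[OF subringE(1)[OF subring_D]]

lemma domain_R: "domain R"
  by (rule subring_is_domain[OF subring_D])

lemma maximalideal_imp_primeideal: "maximalideal M R \<Longrightarrow> primeideal M R"
  using cring.maximalideal_prime[of R] domain_R by (auto simp: domain_def)

lemma maximalideal_exists:
  assumes "ideal I R" "\<one> \<notin> I"
  obtains M where "maximalideal M R" "I \<subseteq> M"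
  by (rule ring.exists_maximalideal[OF subring_is_ring[OF subring_D] assms(1)])
    (use assms(2) in simp_all)

text \<open>Contrapositive of the existence of maximal ideals, in the shape of a local-to-global
  principle: the goal splits into one task per maximal ideal.\<close>

lemma one_mem_idealI:
  assumes "ideal I R" "\<And>M. maximalideal M R \<Longrightarrow> \<not> I \<subseteq> M"
  shows "\<one> \<in> I"
  using maximalideal_exists[OF assms(1)] assms(2) by metis

lemma maximalideal_eq:
  assumes "maximalideal M R" "primeideal P R" "M \<subseteq> P"
  shows "P = M"
proof -
  have P: "ideal P R"
    using assms(2) by (rule primeideal.axioms)
  then show ?thesis
    using maximalideal.I_maximal[OF assms(1) P assms(3)] primeideal.I_notcarr[OF assms(2)]
      additive_subgroup.a_subset[OF ideal.axioms(1)[OF P]] by metis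
qed

end

section \<open>The localization at a prime ideal as a subring of the field\<close>

locale localization = field_subring +
  fixes P
  assumes prime: "primeideal P (K\<lparr>carrier := D\<rparr>)"
begin

abbreviation T where "T \<equiv> localization_at K D P"

lemma ideal_P: "ideal P R"
  and P_prime: "a \<in> D \<Longrightarrow> b \<in> D \<Longrightarrow> a \<otimes> b \<in> P \<Longrightarrow> a \<in> P \<or> b \<in> P"
  and one_notin_P: "\<one> \<notin> P"
  using iffD1[OF primeideal_subring_iff[OF subring_D] prime] by blast+

lemma P_subset: "P \<subseteq> D"
  and zero_in_P: "\<zero> \<in> P"
  and P_mult: "r \<in> D \<Longrightarrow> a \<in> P \<Longrightarrow> r \<otimes> a \<in> P"
  using iffD1[OF ideal_subring_iff[OF subring_D] ideal_P] by blast+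

lemma denom_mult: "s \<in> D - P \<Longrightarrow> t \<in> D - P \<Longrightarrow> s \<otimes> t \<in> D - P"
  using P_prime by auto

lemma denom_one: "\<one> \<in> D - P"
  using one_notin_P by auto

lemma denom_nonzero: "s \<in> D - P \<Longrightarrow> s \<noteq> \<zero>"
  using zero_in_P by auto

lemma denom_inv:
  assumes "s \<in> D - P"
  shows "inv s \<in> carrier K" "s \<otimes> inv s = \<one>" "inv s \<otimes> s = \<one>"
proof -
  have "s \<in> Units K"
    using assms denom_nonzero by (auto simp: field_Units)
  then show "inv s \<in> carrier K" "s \<otimes> inv s = \<one>" "inv s \<otimes> s = \<one>"
    by auto
qed

lemma denom_cancel [simp]:
  assumes "s \<in> D - P" "x \<in> carrier K"
  shows "s \<otimes> (inv s \<otimes> x) = x" "inv s \<otimes> (s \<otimes> x) = x"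
  using assms denom_inv[OF assms(1)] by (simp_all flip: m_assoc)

text \<open>Trades fractions for denominators: later arguments clear a denominator by one
  multiplication and need no name for the numerator.\<close>

lemma mem_localization_iff: "x \<in> T \<longleftrightarrow> x \<in> carrier K \<and> (\<exists>s\<in>D - P. s \<otimes> x \<in> D)"
proof
  assume "x \<in> T"
  then obtain a s where as: "a \<in> D" "s \<in> D - P" "x = a \<otimes> inv s"
    by (auto simp: localization_at_def)
  then have "s \<otimes> x = a"
    using denom_inv[of s] m_comm[of a "inv s"] by auto
  then show "x \<in> carrier K \<and> (\<exists>s\<in>D - P. s \<otimes> x \<in> D)"
    using as denom_inv(1)[OF as(2)] by (auto intro!: bexI[of _ s])
next
  assume "x \<in> carrier K \<and> (\<exists>s\<in>D - P. s \<otimes> x \<in> D)"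
  then obtain s where s: "x \<in> carrier K" "s \<in> D - P" "s \<otimes> x \<in> D"
    by blast
  then have "x = (s \<otimes> x) \<otimes> inv s"
    using denom_inv[of s] m_comm[of "s \<otimes> x" "inv s"] by auto
  then show "x \<in> T"
    using s by (auto simp: localization_at_def)
qed

lemma mem_localizationI: "x \<in> carrier K \<Longrightarrow> s \<in> D - P \<Longrightarrow> s \<otimes> x \<in> D \<Longrightarrow> x \<in> T"
  using mem_localization_iff by blast

lemma mem_localizationE:
  assumes "x \<in> T"
  obtains s where "x \<in> carrier K" "s \<in> D - P" "s \<otimes> x \<in> D"
  using assms mem_localization_iff by blast

lemma D_subset: "D \<subseteq> T"
  by (rule subsetI, rule mem_localizationI[OF _ denom_one]) auto

lemma denom_inv_mem: "s \<in> D - P \<Longrightarrow> inv s \<in> T"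
  using denom_inv[of s] by (intro mem_localizationI[of "inv s" s]) auto

lemma subring_localization: "subring T K"
proof (rule subringI)
  show "T \<subseteq> carrier K" "\<one> \<in> T"
    using D_subset by (auto elim: mem_localizationE)
  show "\<ominus> x \<in> T" if x: "x \<in> T" for x
  proof -
    obtain s where s: "x \<in> carrier K" "s \<in> D - P" "s \<otimes> x \<in> D"
      using x by (rule mem_localizationE)
    then have "s \<otimes> \<ominus> x = \<ominus> (s \<otimes> x)"
      by (auto simp: r_minus)
    then show ?thesis
      using s by (intro mem_localizationI[of _ s]) auto
  qed
  fix x y assume "x \<in> T" "y \<in> T"
  then obtain s t where s: "x \<in> carrier K" "s \<in> D - P" "s \<otimes> x \<in> D"
    and t: "y \<in> carrier K" "t \<in> D - P" "t \<otimes> y \<in> D"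
    by (elim mem_localizationE)
  \<comment> \<open>The product of the two denominators clears both the product and the sum.\<close>
  have "(s \<otimes> t) \<otimes> (x \<otimes> y) = (s \<otimes> x) \<otimes> (t \<otimes> y)"
    using s t by (simp add: m_ac)
  moreover have "(s \<otimes> t) \<otimes> (x \<oplus> y) = t \<otimes> (s \<otimes> x) \<oplus> s \<otimes> (t \<otimes> y)"
    using s t by (simp add: m_ac r_distr)
  ultimately show "x \<otimes> y \<in> T" "x \<oplus> y \<in> T"
    using s t by (auto intro!: mem_localizationI[OF _ denom_mult[OF s(2) t(2)]])
qed

lemmas T_closed [simp, intro] =
  subringE(2,3,5,6,7)[OF subring_localization]
  subsetD[OF subringE(1)[OF subring_localization]] subsetD[OF D_subset]

text \<open>The product of the individual denominators works, since a multiple in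
  \<open>D - P\<close> of a denominator is again a denominator.\<close>

lemma common_denominator:
  assumes "finite F" "F \<subseteq> T"
  obtains s where "s \<in> D - P" "\<And>x. x \<in> F \<Longrightarrow> s \<otimes> x \<in> D"
proof -
  have "\<exists>s\<in>D - P. \<forall>x\<in>F. s \<otimes> x \<in> D"
    using assms
  proof (induction F)
    case empty
    show ?case using denom_one by auto
  next
    case (insert y F)
    then obtain s where s: "s \<in> D - P" "\<forall>x\<in>F. s \<otimes> x \<in> D"
      by blast
    obtain t where t: "t \<in> D - P" "t \<otimes> y \<in> D"
      using insert.prems by (auto elim: mem_localizationE)
    have "t \<otimes> s \<otimes> x \<in> D" if "x \<in> insert y F" for x
    proof -
      have "x \<in> carrier K"
        using that insert.prems by auto
      \<comment> \<open>The first bracketing clears the elements of \<open>F\<close>, by means of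
        \<open>s\<close>; the second clears the new element \<open>y\<close>, by means of
        \<open>t\<close>.\<close>
      then have eq: "t \<otimes> s \<otimes> x = t \<otimes> (s \<otimes> x)" "t \<otimes> s \<otimes> x = s \<otimes> (t \<otimes> x)"
        using s t by (simp_all add: m_ac)
      show ?thesis
      proof (cases "x = y")
        case True
        then show ?thesis
          unfolding eq(2) using s t by auto
      next
        case False
        then show ?thesis
          unfolding eq(1) using that s t by auto
      qed
    qed
    then show ?case
      using denom_mult[OF t(1) s(1)] by blast
  qed
  then show thesis
    using that by blast
qed

text \<open>The elements of \<open>T\<close> that some denominator moves into \<open>I\<close> form
  an ideal of \<open>T\<close> containing \<open>I\<close>, hence include the whole extension of
  \<open>I\<close>.\<close>

lemma genideal_localization_subset:
  assumes I: "ideal I R" and x: "x \<in> Idl\<^bsub>K\<lparr>carrier := T\<rparr>\<^esub> I"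
  obtains s where "s \<in> D - P" "s \<otimes> x \<in> I"
proof -
  have ID: "I \<subseteq> D" "\<zero> \<in> I" and add: "\<And>a b. a \<in> I \<Longrightarrow> b \<in> I \<Longrightarrow> a \<oplus> b \<in> I"
    and mult: "\<And>r a. r \<in> D \<Longrightarrow> a \<in> I \<Longrightarrow> r \<otimes> a \<in> I"
    using iffD1[OF ideal_subring_iff[OF subring_D] I] by blast+
  let ?J = "{x\<in>T. \<exists>s\<in>D - P. s \<otimes> x \<in> I}"
  have "ideal ?J (K\<lparr>carrier := T\<rparr>)"
    unfolding ideal_subring_iff[OF subring_localization]
  proof (intro conjI ballI)
    show "\<zero> \<in> ?J"
      using ID denom_one by auto
    show "x \<oplus> y \<in> ?J" if xy: "x \<in> ?J" "y \<in> ?J" for x y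
    proof -
      obtain s t where s: "x \<in> T" "s \<in> D - P" "s \<otimes> x \<in> I" and t: "y \<in> T" "t \<in> D - P" "t \<otimes> y \<in> I"
        using xy by (elim CollectE conjE bexE)
      have "(s \<otimes> t) \<otimes> (x \<oplus> y) = t \<otimes> (s \<otimes> x) \<oplus> s \<otimes> (t \<otimes> y)"
        using s t by (simp add: m_ac r_distr)
      then have "(s \<otimes> t) \<otimes> (x \<oplus> y) \<in> I"
        using s t add mult by auto
      then show ?thesis
        using s t denom_mult[OF s(2) t(2)] by auto
    qed
    show "r \<otimes> x \<in> ?J" if rx: "r \<in> T" "x \<in> ?J" for r x
    proof -
      obtain s where s: "x \<in> T" "s \<in> D - P" "s \<otimes> x \<in> I"
        using rx by (elim CollectE conjE bexE)
      \<comment> \<open>The scalar \<open>r\<close> lies only in \<open>T\<close>; \<open>t\<close>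
        brings it into \<open>D\<close>, where \<open>I\<close> absorbs it.\<close>
      obtain t where t: "t \<in> D - P" "t \<otimes> r \<in> D"
        using rx(1) by (rule mem_localizationE)
      have "(s \<otimes> t) \<otimes> (r \<otimes> x) = (t \<otimes> r) \<otimes> (s \<otimes> x)"
        using s t rx by (simp add: m_ac)
      then have "(s \<otimes> t) \<otimes> (r \<otimes> x) \<in> I"
        using s t mult by auto
      then show ?thesis
        using s t rx denom_mult[OF s(2) t(1)] by auto
    qed
  qed auto
  moreover have "I \<subseteq> ?J"
    using ID denom_one by (auto intro!: bexI[of _ \<one>])
  ultimately have "Idl\<^bsub>K\<lparr>carrier := T\<rparr>\<^esub> I \<subseteq> ?J"
    using ring.genideal_minimal[OF subring_is_ring[OF subring_localization]] by auto
  then show thesis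
    using x that by blast
qed

text \<open>Contraction preserves primeness. An element of \<open>D - P\<close> is invertible in
  \<open>T\<close>, so it would put \<open>\<one>\<close> into any prime ideal of \<open>T\<close>
  containing it.\<close>

lemma sigma_spec_localizationD:
  assumes "Q \<in> sigma_spec K D T"
  shows "primeideal Q R" "Q \<subseteq> P"
proof -
  obtain Q' where Q: "Q = Q' \<inter> D" and Q': "primeideal Q' (K\<lparr>carrier := T\<rparr>)"
    using assms by (auto simp: sigma_spec_def spectrum_def)
  have Q'': "\<zero> \<in> Q'" "\<one> \<notin> Q'" "\<And>a b. a \<in> Q' \<Longrightarrow> b \<in> Q' \<Longrightarrow> a \<oplus> b \<in> Q'"
    "\<And>r a. r \<in> T \<Longrightarrow> a \<in> Q' \<Longrightarrow> r \<otimes> a \<in> Q'"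
    "\<And>a b. a \<in> T \<Longrightarrow> b \<in> T \<Longrightarrow> a \<otimes> b \<in> Q' \<Longrightarrow> a \<in> Q' \<or> b \<in> Q'"
    using iffD1[OF primeideal_subring_iff[OF subring_localization] Q']
      ideal_subring_iff[OF subring_localization, of Q'] by blast+
  show "primeideal Q R"
    unfolding primeideal_subring_iff[OF subring_D] ideal_subring_iff[OF subring_D] Q
    using Q'' D_subset by auto
  show "Q \<subseteq> P"
  proof
    fix s assume "s \<in> Q"
    then have s: "s \<in> Q'" "s \<in> D"
      using Q by auto
    show "s \<in> P"
    proof (rule ccontr)
      assume "s \<notin> P"
      then have "inv s \<otimes> s \<in> Q'" "inv s \<otimes> s = \<one>"
        using s Q''(4) denom_inv_mem denom_inv by blast+
      then show False
        using Q''(2) by simp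
    qed
  qed
qed

lemma zero_in_sigma_spec: "{\<zero>} \<in> sigma_spec K D T"
proof -
  have "primeideal {\<zero>} (K\<lparr>carrier := T\<rparr>)"
    using domain.zeroprimeideal[OF subring_is_domain[OF subring_localization]] by simp
  moreover have "{\<zero>} = {\<zero>} \<inter> D"
    by auto
  ultimately show ?thesis
    unfolding sigma_spec_def spectrum_def by blast
qed

text \<open>The inverse of a nonzero \<open>p\<close> in \<open>P\<close> would lie in
  \<open>T\<close> and have a denominator \<open>s\<close>; then \<open>s\<close> would be the
  multiple of \<open>p\<close> by an element of \<open>D\<close>, hence in \<open>P\<close>. This
  serves the case where the field itself belongs to the family.\<close>

lemma localization_eq_carrierD:
  assumes "T = carrier K"
  shows "P = {\<zero>}"
proof -
  have False if p: "p \<in> P" "p \<noteq> \<zero>" for p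
  proof -
    have pu: "p \<in> Units K"
      using p P_subset by (auto simp: field_Units)
    then have "inv p \<in> T"
      using assms by simp
    then obtain s where s: "s \<in> D - P" "s \<otimes> inv p \<in> D"
      by (rule mem_localizationE)
    have "(s \<otimes> inv p) \<otimes> p = s"
      using pu s by (simp add: m_assoc Units_closed)
    then show False
      using P_mult[OF s(2) p(1)] s(1) by simp
  qed
  then show ?thesis
    using zero_in_P by blast
qed

end


subsection \<open>Flatness\<close>

context localization
begin

lemma module_localization: "Module.module R (subring_module K T)"
proof (rule moduleI)
  show "cring R"
    using domain_R by (simp add: domain_def)
  show "abelian_group (subring_module K T)"
  proof (rule abelian_groupI)
    show "\<exists>y\<in>carrier (subring_module K T). y \<oplus>\<^bsub>subring_module K T\<^esub> x = \<zero>\<^bsub>subring_module K T\<^esub>"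
      if "x \<in> carrier (subring_module K T)" for x
      using that by (auto simp: subring_module_def l_neg intro!: bexI[of _ "\<ominus> x"])
  qed (auto simp: subring_module_def a_ac)
qed (auto simp: subring_module_def l_distr r_distr m_assoc)

lemma carrier_subring_module [simp]: "carrier (subring_module K T) = T"
  and smult_subring_module [simp]: "r \<odot>\<^bsub>subring_module K T\<^esub> t = r \<otimes> t"
  and add_subring_module [simp]: "t \<oplus>\<^bsub>subring_module K T\<^esub> u = t \<oplus> u"
  by (simp_all add: subring_module_def)

text \<open>Bounds the null combinations from above: the bilinearity relations kill \<open>n\<close>
  over \<open>s\<close> only for the evident reason, that some denominator annihilates
  \<open>n\<close>.\<close>

lemma tensor_null_fractionD:
  fixes N :: "('a, 'n) module"
  assumes N: "Module.module R N" and n: "n \<in> carrier N" and s: "s \<in> D - P"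
    and null: "frag_of (n, inv s) \<in> tensor_null R N (subring_module K T)"
  obtains u where "u \<in> D - P" "u \<odot>\<^bsub>N\<^esub> n = \<zero>\<^bsub>N\<^esub>"
proof -
  interpret N: Module.module R N by (rule N)
  let ?S = "D - P" and ?X = "carrier N \<times> T"
  \<comment> \<open>The maps \<open>(x, t) \<mapsto> (s t) x\<close>, one for each denominator \<open>s\<close>, replace the map from the tensor
    product to the localization of \<open>N\<close>, which is thus not constructed. Their values matter only
    for those \<open>s\<close> that clear all denominators occurring in a given tensor.\<close>
  let ?g = "\<lambda>s (x, t). if s \<otimes> t \<in> D then (s \<otimes> t) \<odot>\<^bsub>N\<^esub> x else \<zero>\<^bsub>N\<^esub>"
  have "\<forall>s. \<exists>h. h \<in> hom (free_Abelian_group ?X) (add_monoid N) \<and> (\<forall>p\<in>?X. h (frag_of p) = ?g s p)"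
  proof
    fix s
    have "?g s ` ?X \<subseteq> carrier (add_monoid N)"
      by auto
    then obtain h where "h \<in> hom (free_Abelian_group ?X) (add_monoid N)"
      "\<And>p. p \<in> ?X \<Longrightarrow> h (frag_of p) = ?g s p"
      by (rule comm_group.free_Abelian_group_universal[OF N.M.a_comm_group]) (rule that)
    then show "\<exists>h. h \<in> hom (free_Abelian_group ?X) (add_monoid N) \<and> (\<forall>p\<in>?X. h (frag_of p) = ?g s p)"
      by blast
  qed
  from choice[OF this] obtain h where h: "\<forall>s. h s \<in> hom (free_Abelian_group ?X) (add_monoid N) \<and>
      (\<forall>p\<in>?X. h s (frag_of p) = ?g s p)"
    by (rule exE)
  have hom: "h s \<in> hom (free_Abelian_group ?X) (add_monoid N)" for s
    using h by blast
  have h_frag_of: "h s (frag_of (x, t)) = (if s \<otimes> t \<in> D then (s \<otimes> t) \<odot>\<^bsub>N\<^esub> x else \<zero>\<^bsub>N\<^esub>)"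
    if "x \<in> carrier N" "t \<in> T" for s x t
    using h that by simp
  interpret h: group_hom "free_Abelian_group ?X" "add_monoid N" "h r" for r
    by (intro group_hom.intro group_hom_axioms.intro hom N.M.a_group group_free_Abelian_group)
  have h_zero: "h s 0 = \<zero>\<^bsub>N\<^esub>" for s
    using h.hom_one[of s] by simp
  have h_add: "h s (y + z) = h s y \<oplus>\<^bsub>N\<^esub> h s z"
    if "Poly_Mapping.keys y \<subseteq> ?X" "Poly_Mapping.keys z \<subseteq> ?X" for s y z
    using h.hom_mult[of y z s] that by simp
  have h_uminus: "h s (- z) = \<ominus>\<^bsub>N\<^esub> h s z" if "Poly_Mapping.keys z \<subseteq> ?X" for s z
    using h.hom_inv[of z s] that by (simp add: a_inv_def)
  have h_diff: "h s (y - z) = h s y \<ominus>\<^bsub>N\<^esub> h s z"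
    if "Poly_Mapping.keys y \<subseteq> ?X" "Poly_Mapping.keys z \<subseteq> ?X" for s y z
    using h_add[of y "- z" s] h_uminus[of z s] that by (simp add: a_minus_def)
  \<comment> \<open>Asking for all multiples \<open>s \<otimes> u\<close> makes \<open>?H\<close>
    closed under addition: the product of the witnesses of two summands is a witness for their
    sum.\<close>
  let ?H = "{z. Poly_Mapping.keys z \<subseteq> ?X \<and> (\<exists>s\<in>?S. \<forall>u\<in>?S. h (s \<otimes> u) z = \<zero>\<^bsub>N\<^esub>)}"
  have sub: "subgroup ?H (tensor_free N (subring_module K T))"
    unfolding tensor_free_def carrier_subring_module
  proof (rule group.subgroupI)
    show "?H \<noteq> {}"
      using denom_one h_zero by (auto intro!: exI[of _ 0])
    show "inv\<^bsub>free_Abelian_group ?X\<^esub> z \<in> ?H" if z: "z \<in> ?H" for z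
    proof -
      obtain s where s: "s \<in> ?S" "\<forall>u\<in>?S. h (s \<otimes> u) z = \<zero>\<^bsub>N\<^esub>"
        using z by blast
      have "\<forall>u\<in>?S. h (s \<otimes> u) (- z) = \<zero>\<^bsub>N\<^esub>"
        using z s(2) h_uminus by simp
      then show ?thesis
        using z s(1) by auto
    qed
    show "y \<otimes>\<^bsub>free_Abelian_group ?X\<^esub> z \<in> ?H" if yz: "y \<in> ?H" "z \<in> ?H" for y z
    proof -
      obtain s t where s: "s \<in> ?S" "\<forall>u\<in>?S. h (s \<otimes> u) y = \<zero>\<^bsub>N\<^esub>"
        and t: "t \<in> ?S" "\<forall>u\<in>?S. h (t \<otimes> u) z = \<zero>\<^bsub>N\<^esub>"
        using yz by blast
      have "h ((s \<otimes> t) \<otimes> u) (y + z) = \<zero>\<^bsub>N\<^esub>" if u: "u \<in> ?S" for u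
      proof -
        have "(s \<otimes> t) \<otimes> u = s \<otimes> (t \<otimes> u)" "(s \<otimes> t) \<otimes> u = t \<otimes> (s \<otimes> u)"
          using s t u by (simp_all add: m_ac)
        then have "h ((s \<otimes> t) \<otimes> u) y = \<zero>\<^bsub>N\<^esub>" "h ((s \<otimes> t) \<otimes> u) z = \<zero>\<^bsub>N\<^esub>"
          using s t denom_mult[OF s(1) u] denom_mult[OF t(1) u] by metis+
        then show ?thesis
          using yz h_add by simp
      qed
      then have "\<exists>s\<in>?S. \<forall>u\<in>?S. h (s \<otimes> u) (y + z) = \<zero>\<^bsub>N\<^esub>"
        using denom_mult[OF s(1) t(1)] by blast
      moreover have "Poly_Mapping.keys (y + z) \<subseteq> ?X"
        using yz keys_add[of y z] by blast
      ultimately show ?thesis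
        by simp
    qed
  qed auto
  have H_I: "z \<in> ?H"
    if "Poly_Mapping.keys z \<subseteq> ?X" "s \<in> ?S" "\<And>u. u \<in> ?S \<Longrightarrow> h (s \<otimes> u) z = \<zero>\<^bsub>N\<^esub>" for z s
    using that by blast
  have cancel: "(x \<oplus>\<^bsub>N\<^esub> y) \<ominus>\<^bsub>N\<^esub> x \<ominus>\<^bsub>N\<^esub> y = \<zero>\<^bsub>N\<^esub>" if "x \<in> carrier N" "y \<in> carrier N" for x y
    using that N.M.a_comm[of x y] by (simp add: a_minus_def N.M.a_assoc N.M.r_neg)
  have keys: "Poly_Mapping.keys (y - z) \<subseteq> ?X"
    if "Poly_Mapping.keys y \<subseteq> ?X" "Poly_Mapping.keys z \<subseteq> ?X" for y z
    using that keys_diff[of y z] by blast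
  \<comment> \<open>Every multiple of a common denominator is again one, so at \<open>t\<close> and
    \<open>t'\<close> the maps \<open>h (s \<otimes> u)\<close> take the intended value and not the
    default zero.\<close>
  have denom: "\<exists>s\<in>?S. \<forall>u\<in>?S. (s \<otimes> u) \<otimes> t \<in> D \<and> (s \<otimes> u) \<otimes> t' \<in> D" if tt': "t \<in> T" "t' \<in> T" for t t'
  proof -
    obtain s where s: "s \<in> ?S" "\<And>x. x \<in> {t, t'} \<Longrightarrow> s \<otimes> x \<in> D"
      using common_denominator[of "{t, t'}"] tt' by auto
    have "(s \<otimes> u) \<otimes> x \<in> D" if "u \<in> ?S" "x \<in> {t, t'}" for u x
    proof -
      have "(s \<otimes> u) \<otimes> x = u \<otimes> (s \<otimes> x)"
        using s that tt' by (auto simp: m_ac)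
      then show ?thesis
        using s that by auto
    qed
    then show ?thesis
      using s by blast
  qed
  have "tensor_null R N (subring_module K T) \<subseteq> ?H"
  proof (rule tensor_null_subset[OF N module_localization sub]; unfold carrier_subring_module
      smult_subring_module add_subring_module)
    fix x y t assume a: "x \<in> carrier N" "y \<in> carrier N" "t \<in> T"
    then obtain s where s: "s \<in> ?S" "\<And>u. u \<in> ?S \<Longrightarrow> (s \<otimes> u) \<otimes> t \<in> D"
      using denom[of t t] by blast
    have "h (s \<otimes> u) (frag_of (x \<oplus>\<^bsub>N\<^esub> y, t) - frag_of (x, t) - frag_of (y, t)) = \<zero>\<^bsub>N\<^esub>"
      if "u \<in> ?S" for u
    proof -
      have "((s \<otimes> u) \<otimes> t) \<odot>\<^bsub>N\<^esub> (x \<oplus>\<^bsub>N\<^esub> y)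
          = ((s \<otimes> u) \<otimes> t) \<odot>\<^bsub>N\<^esub> x \<oplus>\<^bsub>N\<^esub> ((s \<otimes> u) \<otimes> t) \<odot>\<^bsub>N\<^esub> y"
        using a s(2)[OF that] by (simp add: N.smult_r_distr)
      then show ?thesis
        using a s(2)[OF that]
        by (simp add: h_diff keys h_frag_of cancel)
    qed
    then show "frag_of (x \<oplus>\<^bsub>N\<^esub> y, t) - frag_of (x, t) - frag_of (y, t) \<in> ?H"
      using a by (intro H_I[OF _ s(1)]) (simp_all add: keys)
  next
    fix x t t' assume a: "x \<in> carrier N" "t \<in> T" "t' \<in> T"
    then obtain s where s: "s \<in> ?S" "\<And>u. u \<in> ?S \<Longrightarrow> (s \<otimes> u) \<otimes> t \<in> D"
      "\<And>u. u \<in> ?S \<Longrightarrow> (s \<otimes> u) \<otimes> t' \<in> D"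
      using denom[of t t'] by blast
    have "h (s \<otimes> u) (frag_of (x, t \<oplus> t') - frag_of (x, t) - frag_of (x, t')) = \<zero>\<^bsub>N\<^esub>"
      if "u \<in> ?S" for u
    proof -
      have eq: "(s \<otimes> u) \<otimes> (t \<oplus> t') = (s \<otimes> u) \<otimes> t \<oplus> (s \<otimes> u) \<otimes> t'"
        using a s(1) that by (simp add: r_distr)
      moreover have "((s \<otimes> u) \<otimes> (t \<oplus> t')) \<odot>\<^bsub>N\<^esub> x
          = ((s \<otimes> u) \<otimes> t) \<odot>\<^bsub>N\<^esub> x \<oplus>\<^bsub>N\<^esub> ((s \<otimes> u) \<otimes> t') \<odot>\<^bsub>N\<^esub> x"
        unfolding eq using a s(2,3)[OF that] N.smult_l_distr by simp
      moreover have "(s \<otimes> u) \<otimes> (t \<oplus> t') \<in> D"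
        unfolding eq using s(2,3)[OF that] by simp
      ultimately show ?thesis
        using a s(2,3)[OF that]
        by (simp add: h_diff keys h_frag_of cancel)
    qed
    then show "frag_of (x, t \<oplus> t') - frag_of (x, t) - frag_of (x, t') \<in> ?H"
      using a by (intro H_I[OF _ s(1)]) (simp_all add: keys)
  next
    fix r x t assume a: "r \<in> carrier R" "x \<in> carrier N" "t \<in> T"
    then obtain s where s: "s \<in> ?S" "\<And>u. u \<in> ?S \<Longrightarrow> (s \<otimes> u) \<otimes> t \<in> D"
      using denom[of t t] by blast
    have "h (s \<otimes> u) (frag_of (r \<odot>\<^bsub>N\<^esub> x, t) - frag_of (x, r \<otimes> t)) = \<zero>\<^bsub>N\<^esub>"
      if "u \<in> ?S" for u
    proof -
      have eq: "(s \<otimes> u) \<otimes> (r \<otimes> t) = ((s \<otimes> u) \<otimes> t) \<otimes> r"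
        using a s(1) that by (simp add: m_ac)
      moreover have "((s \<otimes> u) \<otimes> (r \<otimes> t)) \<odot>\<^bsub>N\<^esub> x = ((s \<otimes> u) \<otimes> t) \<odot>\<^bsub>N\<^esub> (r \<odot>\<^bsub>N\<^esub> x)"
        unfolding eq using a s(2)[OF that] N.smult_assoc1 by simp
      moreover have "(s \<otimes> u) \<otimes> (r \<otimes> t) \<in> D"
        unfolding eq using a s(2)[OF that] by simp
      ultimately show ?thesis
        using a s(2)[OF that]
        by (simp add: h_diff keys h_frag_of a_minus_def N.M.r_neg)
    qed
    then show "frag_of (r \<odot>\<^bsub>N\<^esub> x, t) - frag_of (x, r \<otimes> t) \<in> ?H"
      using a by (intro H_I[OF _ s(1)]) (simp_all add: keys)
  qed
  from CollectD[OF subsetD[OF this null], THEN conjunct2]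
  obtain v where v: "v \<in> ?S" "\<forall>u\<in>?S. h (v \<otimes> u) (frag_of (n, inv s)) = \<zero>\<^bsub>N\<^esub>"
    by (rule bexE)
  \<comment> \<open>Choosing \<open>u = s\<close> turns the entry \<open>inv s\<close> into the
    scalar \<open>v\<close> of \<open>D\<close>, so the vanishing value is \<open>v\<close> times
    \<open>n\<close>.\<close>
  have "(v \<otimes> s) \<otimes> inv s = v"
    using v(1) s denom_inv[OF s] by (simp add: m_assoc)
  then have "v \<odot>\<^bsub>N\<^esub> n = \<zero>\<^bsub>N\<^esub>"
    using v(1) bspec[OF v(2) s] h_frag_of[OF n denom_inv_mem[OF s], of "v \<otimes> s"] by simp
  with v(1) show thesis
    by (rule that)
qed

section \<open>Elements of the tensor product as single fractions\<close>

context
  fixes M :: "('a, 'm) module"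
  assumes M: "Module.module R M"
begin

interpretation M: Module.module R M by (rule M)

text \<open>Expansion of a fraction: \<open>inv s\<close> is the multiple of
  \<open>inv (s \<otimes> u)\<close> by \<open>u\<close>, and the scalar \<open>u\<close> moves
  across the tensor sign.\<close>

lemma tensor_null_rescale:
  assumes x: "x \<in> carrier M" and s: "s \<in> D - P" and u: "u \<in> D - P"
  shows "frag_of (x, inv s) - frag_of (u \<odot>\<^bsub>M\<^esub> x, inv (s \<otimes> u)) \<in> tensor_null R M (subring_module K T)"
proof -
  note su = denom_mult[OF s u]
  have "inv s = inv s \<otimes> ((s \<otimes> u) \<otimes> inv (s \<otimes> u))"
    using denom_inv[OF s] denom_inv[OF su] by simp
  also have "\<dots> = inv s \<otimes> (s \<otimes> (u \<otimes> inv (s \<otimes> u)))"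
    using s u denom_inv[OF su] by (simp add: m_assoc)
  also have "\<dots> = u \<otimes> inv (s \<otimes> u)"
    using s u denom_inv[OF su] by (simp)
  finally have eq: "u \<otimes> inv (s \<otimes> u) = inv s" ..
  have "frag_of (u \<odot>\<^bsub>M\<^esub> x, inv (s \<otimes> u)) - frag_of (x, inv s) \<in> tensor_null R M (subring_module K T)"
    using tensor_null_bilinear(3)[OF M module_localization, of u x "inv (s \<otimes> u)"]
      u x denom_inv_mem[OF su] by (simp add: eq)
  from tensor_null_uminus[OF M module_localization this] show ?thesis
    by simp
qed

lemma tensor_eq_fraction:
  assumes "Poly_Mapping.keys z \<subseteq> carrier M \<times> T"
  shows "\<exists>x\<in>carrier M. \<exists>s\<in>D - P. z - frag_of (x, inv s) \<in> tensor_null R M (subring_module K T)"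
    (is "\<exists>x\<in>_. \<exists>s\<in>_. _ \<in> ?N")
  using assms
proof (induction z rule: frag_induction)
  case zero
  have "- frag_of (\<zero>\<^bsub>M\<^esub>, inv \<one>) \<in> ?N"
    using tensor_null_frag_of_zero[OF M module_localization] denom_inv_mem[OF denom_one]
    by (intro tensor_null_uminus[OF M module_localization]) auto
  then show ?case
    using denom_one by (auto intro!: bexI[of _ "\<zero>\<^bsub>M\<^esub>"] bexI[of _ \<one>])
next
  case (diff y z)
  then obtain x\<^sub>1 s\<^sub>1 x\<^sub>2 s\<^sub>2 where 1: "x\<^sub>1 \<in> carrier M" "s\<^sub>1 \<in> D - P" "y - frag_of (x\<^sub>1, inv s\<^sub>1) \<in> ?N"
    and 2: "x\<^sub>2 \<in> carrier M" "s\<^sub>2 \<in> D - P" "z - frag_of (x\<^sub>2, inv s\<^sub>2) \<in> ?N"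
    by blast
  let ?w = "inv (s\<^sub>1 \<otimes> s\<^sub>2)" and ?y = "s\<^sub>2 \<odot>\<^bsub>M\<^esub> x\<^sub>1" and ?z = "s\<^sub>1 \<odot>\<^bsub>M\<^esub> x\<^sub>2"
  have comm: "s\<^sub>2 \<otimes> s\<^sub>1 = s\<^sub>1 \<otimes> s\<^sub>2"
    using 1 2 by (simp add: m_comm)
  have yz: "?y \<in> carrier M" "?z \<in> carrier M" "?y \<ominus>\<^bsub>M\<^esub> ?z \<in> carrier M"
    using 1 2 by auto
  have "(?y \<ominus>\<^bsub>M\<^esub> ?z) \<oplus>\<^bsub>M\<^esub> ?z = ?y"
    using yz by (simp add: a_minus_def M.M.a_assoc M.M.l_neg)
  then have a: "frag_of (?y, ?w) - frag_of (?y \<ominus>\<^bsub>M\<^esub> ?z, ?w) - frag_of (?z, ?w) \<in> ?N"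
    using tensor_null_bilinear(1)[OF M module_localization, of "?y \<ominus>\<^bsub>M\<^esub> ?z" ?z ?w] yz
      denom_inv_mem[OF denom_mult[OF 1(2) 2(2)]] by simp
  have b: "frag_of (x\<^sub>1, inv s\<^sub>1) - frag_of (?y, ?w) \<in> ?N"
    using tensor_null_rescale[OF 1(1,2) 2(2)] .
  have c: "frag_of (x\<^sub>2, inv s\<^sub>2) - frag_of (?z, ?w) \<in> ?N"
    using tensor_null_rescale[OF 2(1,2) 1(2)] by (simp add: comm)
  note add = tensor_null_add[OF M module_localization]
    and sub = tensor_null_diff[OF M module_localization]
  \<comment> \<open>Telescoping: both fractions are expanded to the denominator
    \<open>s\<^sub>1 \<otimes> s\<^sub>2\<close>, where additivity in the first entry merges
    them.\<close>
  from add[OF add[OF sub[OF 1(3) 2(3)] sub[OF b c]] a]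
  have "y - z - frag_of (?y \<ominus>\<^bsub>M\<^esub> ?z, ?w) \<in> ?N"
    by (simp add: algebra_simps)
  then show ?case
    using yz denom_mult[OF 1(2) 2(2)] by blast
next
  case (one p)
  then obtain x t where p: "p = (x, t)" "x \<in> carrier M" "t \<in> T"
    by auto
  obtain s where s: "s \<in> D - P" "s \<otimes> t \<in> D"
    using p(3) by (rule mem_localizationE)
  \<comment> \<open>This exhibits \<open>t\<close> as the multiple of \<open>inv s\<close> by an
    element of \<open>D\<close>, a scalar that can be moved to \<open>x\<close>.\<close>
  have eq: "(s \<otimes> t) \<otimes> inv s = t"
    using s p denom_inv[OF s(1)] m_comm[of "s \<otimes> t" "inv s"] by auto
  have "frag_of ((s \<otimes> t) \<odot>\<^bsub>M\<^esub> x, inv s) - frag_of (x, t) \<in> ?N"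
    using tensor_null_bilinear(3)[OF M module_localization, of "s \<otimes> t" x "inv s"]
      s p denom_inv_mem[OF s(1)] by (simp add: eq)
  from tensor_null_uminus[OF M module_localization this]
  have "frag_of p - frag_of ((s \<otimes> t) \<odot>\<^bsub>M\<^esub> x, inv s) \<in> ?N"
    using p by simp
  then show ?case
    using s p by (intro bexI[of _ "(s \<otimes> t) \<odot>\<^bsub>M\<^esub> x"] bexI[of _ s]) auto
qed

end

text \<open>For a tensor \<open>x\<close> over \<open>s\<close> in the kernel, some denominator
  \<open>u\<close> annihilates \<open>f x\<close>, hence \<open>x\<close> by injectivity of
  \<open>f\<close>. Expanding the fraction by \<open>u\<close> then shows that it is null.\<close>

lemma flat_localization: "flat_module TYPE('m) TYPE('n) R (subring_module K T)"
  unfolding flat_module_def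
proof (intro conjI module_localization allI impI, elim conjE)
  fix M :: "('a, 'm) module" and N :: "('a, 'n) module" and f
  assume M: "Module.module R M" and N: "Module.module R N"
    and f: "f \<in> module_hom_set R M N" and inj: "inj_on f (carrier M)"
  interpret M: Module.module R M by (rule M)
  interpret N: Module.module R N by (rule N)
  let ?F = "frag_extend (\<lambda>(x, t). frag_of (f x, t))"
  have f_closed: "f x \<in> carrier N" if "x \<in> carrier M" for x
    using f that by (auto simp: module_hom_set_def)
  have f_smult: "f (r \<odot>\<^bsub>M\<^esub> x) = r \<odot>\<^bsub>N\<^esub> f x" if "r \<in> D" "x \<in> carrier M" for r x
    using f that by (auto simp: module_hom_set_def)
  \<comment> \<open>Membership in \<open>module_hom_set\<close> speaks of sums and scalars, so the
    value at zero is obtained from the zero scalar.\<close>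
  have f_zero: "f \<zero>\<^bsub>M\<^esub> = \<zero>\<^bsub>N\<^esub>"
    using f_smult[of \<zero> "\<zero>\<^bsub>M\<^esub>"] M.smult_l_null[of "\<zero>\<^bsub>M\<^esub>"] N.smult_l_null[of "f \<zero>\<^bsub>M\<^esub>"] f_closed
    by simp
  show "inj_on (tensor_map R N (subring_module K T) f)
      (carrier (tensor_product R M (subring_module K T)))"
  proof (rule inj_on_tensor_map[OF M N module_localization f])
    fix z
    assume z: "Poly_Mapping.keys z \<subseteq> carrier M \<times> carrier (subring_module K T)"
      and Fz: "?F z \<in> tensor_null R N (subring_module K T)"
    then obtain x s where x: "x \<in> carrier M" and s: "s \<in> D - P"
      and zx: "z - frag_of (x, inv s) \<in> tensor_null R M (subring_module K T)"
      using tensor_eq_fraction[OF M, of z] by auto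
    have "?F z - ?F (z - frag_of (x, inv s)) \<in> tensor_null R N (subring_module K T)"
      by (intro tensor_null_diff[OF N module_localization Fz]
          frag_extend_tensor_null[OF M N module_localization f zx])
    then have "frag_of (f x, inv s) \<in> tensor_null R N (subring_module K T)"
      by (simp add: frag_extend_diff)
    then obtain u where u: "u \<in> D - P" "u \<odot>\<^bsub>N\<^esub> f x = \<zero>\<^bsub>N\<^esub>"
      using tensor_null_fractionD[OF N f_closed[OF x] s] by blast
    then have "f (u \<odot>\<^bsub>M\<^esub> x) = f \<zero>\<^bsub>M\<^esub>"
      using f_smult[of u x] x f_zero by simp
    then have "u \<odot>\<^bsub>M\<^esub> x = \<zero>\<^bsub>M\<^esub>"
      using inj_onD[OF inj] u x by auto
    then have "frag_of (x, inv s) - frag_of (\<zero>\<^bsub>M\<^esub>, inv (s \<otimes> u)) \<in> tensor_null R M (subring_module K T)"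
      using tensor_null_rescale[OF M x s u(1)] by simp
    moreover have "frag_of (\<zero>\<^bsub>M\<^esub>, inv (s \<otimes> u)) \<in> tensor_null R M (subring_module K T)"
      using tensor_null_frag_of_zero[OF M module_localization] denom_inv_mem[OF denom_mult[OF s u(1)]]
      by simp
    ultimately have "frag_of (x, inv s) \<in> tensor_null R M (subring_module K T)"
      using tensor_null_add[OF M module_localization] by fastforce
    then show "z \<in> tensor_null R M (subring_module K T)"
      using tensor_null_add[OF M module_localization zx, of "frag_of (x, inv s)"] by simp
  qed
qed

end


section \<open>The family of localizations at the maximal ideals\<close>

text \<open>The subbasic sets already form a basis: containing \<open>F\<close> and containing
  \<open>G\<close> together amount to containing the finite set \<open>F \<union> G\<close>.\<close>

lemma openin_zariski_basis:
  assumes "openin (zariski_topology K D) U" "T \<in> U"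
  obtains F where "finite F" "F \<subseteq> T" "{T' \<in> overrings K D. F \<subseteq> T'} \<subseteq> U"
proof -
  have "generate_topology_on {{T \<in> overrings K D. F \<subseteq> T} | F. finite F \<and> F \<subseteq> carrier K} U"
    using assms(1) unfolding zariski_topology_def by (rule openin_topology_generated_by)
  then have "\<forall>T\<in>U. \<exists>F. finite F \<and> F \<subseteq> T \<and> {T' \<in> overrings K D. F \<subseteq> T'} \<subseteq> U"
  proof induction
    case (Int a b)
    show ?case
    proof
      fix T assume "T \<in> a \<inter> b"
      then obtain F G where "finite F" "F \<subseteq> T" "{T' \<in> overrings K D. F \<subseteq> T'} \<subseteq> a"
        "finite G" "G \<subseteq> T" "{T' \<in> overrings K D. G \<subseteq> T'} \<subseteq> b"
        using Int.IH by (meson IntD1 IntD2)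
      then have "finite (F \<union> G) \<and> F \<union> G \<subseteq> T \<and> {T' \<in> overrings K D. F \<union> G \<subseteq> T'} \<subseteq> a \<inter> b"
        by auto
      then show "\<exists>F. finite F \<and> F \<subseteq> T \<and> {T' \<in> overrings K D. F \<subseteq> T'} \<subseteq> a \<inter> b"
        by (rule exI)
    qed
  next
    case (UN A)
    show ?case
    proof
      fix T assume "T \<in> \<Union>A"
      then obtain a where a: "a \<in> A" "T \<in> a"
        by (rule UnionE)
      then obtain F where "finite F" "F \<subseteq> T" "{T' \<in> overrings K D. F \<subseteq> T'} \<subseteq> a"
        using UN.IH by meson
      then have "finite F \<and> F \<subseteq> T \<and> {T' \<in> overrings K D. F \<subseteq> T'} \<subseteq> \<Union>A"
        using Union_upper[OF a(1)] by simp
      then show "\<exists>F. finite F \<and> F \<subseteq> T \<and> {T' \<in> overrings K D. F \<subseteq> T'} \<subseteq> \<Union>A"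
        by (rule exI)
    qed
  next
    case (Basis s)
    then obtain F where F: "s = {T \<in> overrings K D. F \<subseteq> T}" "finite F"
      by blast
    show ?case
      unfolding F(1) using F(2) by auto
  qed simp
  then show thesis
    using assms(2) that by meson
qed

lemma topspace_zariski: "topspace (zariski_topology K D) = overrings K D"
proof -
  \<comment> \<open>The empty set of conditions makes the set of all overrings a subbasic open
    set.\<close>
  have "{T \<in> overrings K D. {} \<subseteq> T} \<in> {{T \<in> overrings K D. F \<subseteq> T} | F. finite F \<and> F \<subseteq> carrier K}"
    by (intro CollectI exI[of _ "{}"]) simp
  then show ?thesis
    unfolding zariski_topology_def topology_generated_by_topspace by auto
qed

section \<open>The defining conditions of a pre-Jaffard family\<close>

context field_subring
begin

lemma zero_ideal_prime: "primeideal {\<zero>} R"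
  using domain.zeroprimeideal[OF domain_R] by simp

lemma ideal_imp_zero_mem: "ideal I R \<Longrightarrow> \<zero> \<in> I"
  using iffD1[OF ideal_subring_iff[OF subring_D]] by blast

lemma localizationI: "maximalideal M R \<Longrightarrow> localization K D M"
  by (intro localization.intro localization_axioms.intro field_subring_axioms maximalideal_imp_primeideal)

lemma localization_mem_overrings: "maximalideal M R \<Longrightarrow> localization_at K D M \<in> overrings K D"
  using localization.subring_localization[OF localizationI] localization.D_subset[OF localizationI]
  by (simp add: overrings_def)

text \<open>A nonzero prime strictly inside a maximal ideal would complete a chain of length 2 that
  starts at the zero ideal, which is prime because \<open>D\<close> is a domain.\<close>

lemma nonzero_prime_maximal:
  assumes dim: "krull_dim R \<le> 1" and P: "primeideal P R" "P \<noteq> {\<zero>}"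
  shows "maximalideal P R"
proof -
  have PI: "ideal P R" "\<one> \<notin> P"
    using iffD1[OF primeideal_subring_iff[OF subring_D] P(1)] by blast+
  then obtain M where M: "maximalideal M R" "P \<subseteq> M"
    using maximalideal_exists by metis
  have "P = M"
  proof (rule ccontr)
    assume "P \<noteq> M"
    define C where "C i = (if i = 0 then {\<zero>} else if i = 1 then P else M)" for i :: nat
    have "\<forall>i\<le>2. C i \<in> spectrum R"
      using zero_ideal_prime P(1) maximalideal_imp_primeideal[OF M(1)]
      by (simp add: C_def spectrum_def)
    moreover have "{\<zero>} \<subset> P" "P \<subset> M"
      using ideal_imp_zero_mem[OF PI(1)] P(2) M(2) \<open>P \<noteq> M\<close> by auto
    then have "\<forall>i<2. C i \<subset> C (Suc i)"
      by (simp add: C_def less_2_cases_iff)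
    ultimately have "enat 2 \<le> krull_dim R"
      unfolding krull_dim_def by (intro Sup_upper) blast
    then have "enat 2 \<le> 1"
      using dim by (rule order_trans)
    then show False
      by (simp add: one_enat_def)
  qed
  then show ?thesis
    using M(1) by simp
qed

abbreviation max_localizations where
  "max_localizations \<equiv> {localization_at K D M | M. M \<in> max_spectrum R}"

lemma max_localizations_eq: "max_localizations = localization_at K D ` {M. maximalideal M R}"
  unfolding max_spectrum_def by blast

lemma complete_max_localizations: "complete_family K D max_localizations"
  unfolding complete_family_def
proof (intro allI impI)
  fix I assume I: "ideal I R"
  note I' = iffD1[OF ideal_subring_iff[OF subring_D] I]
  have "x \<in> I" if x: "\<And>M. maximalideal M R \<Longrightarrow> x \<in> Idl\<^bsub>K\<lparr>carrier := localization_at K D M\<rparr>\<^esub> I" for x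
  proof -
    \<comment> \<open>One maximal ideal is fixed first to place \<open>x\<close> in the field; over
      an empty family the intersection would be the whole type.\<close>
    have "\<one> \<in> D" "\<one> \<notin> {\<zero>}"
      by auto
    then obtain M\<^sub>0 where M\<^sub>0: "maximalideal M\<^sub>0 R"
      using maximalideal_exists[of "{\<zero>}"] primeideal.axioms(1)[OF zero_ideal_prime] by blast
    interpret L: localization K D M\<^sub>0
      by (rule localizationI[OF M\<^sub>0])
    obtain s where s: "s \<in> D - M\<^sub>0" "s \<otimes> x \<in> I"
      using L.genideal_localization_subset[OF I x[OF M\<^sub>0]] by blast
    have "I \<subseteq> localization_at K D M\<^sub>0"
      using I' L.D_subset by blast
    then have "Idl\<^bsub>K\<lparr>carrier := localization_at K D M\<^sub>0\<rparr>\<^esub> I \<subseteq> localization_at K D M\<^sub>0"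
      using ideal.Icarr[OF ring.genideal_ideal[OF subring_is_ring[OF L.subring_localization]]]
      by (intro subsetI) fastforce
    then have xK: "x \<in> carrier K"
      using x[OF M\<^sub>0] L.T_closed by blast
    let ?J = "{d \<in> D. d \<otimes> x \<in> I}"
    have "ideal ?J R"
      unfolding ideal_subring_iff[OF subring_D]
    proof (intro conjI ballI)
      show "\<zero> \<in> ?J"
        using I' xK by simp
      show "a \<oplus> b \<in> ?J" if "a \<in> ?J" "b \<in> ?J" for a b
        using that I' xK by (simp add: l_distr)
      show "r \<otimes> a \<in> ?J" if "r \<in> D" "a \<in> ?J" for r a
        using that I' xK by (simp add: m_assoc)
    qed blast
    then have "\<one> \<in> ?J"
    proof (rule one_mem_idealI)
      fix M assume M: "maximalideal M R"
      show "\<not> ?J \<subseteq> M"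
        \<comment> \<open>Membership of \<open>x\<close> in the extension of \<open>I\<close> to the
          localization at \<open>M\<close> supplies an element of \<open>?J\<close> outside
          \<open>M\<close>.\<close>
        using localization.genideal_localization_subset[OF localizationI[OF M] I x[OF M]] by blast
    qed
    then show ?thesis
      using xK by simp
  qed
  moreover have "x \<in> Idl\<^bsub>K\<lparr>carrier := localization_at K D M\<rparr>\<^esub> I" if "x \<in> I" for M x
    using that unfolding genideal_def by blast
  ultimately show "I = (\<Inter>T\<in>max_localizations. Idl\<^bsub>K\<lparr>carrier := T\<rparr>\<^esub> I)"
    unfolding max_localizations_eq by (intro equalityI subsetI INT_I) auto
qed

lemma independent_max_localizations:
  assumes "krull_dim R \<le> 1"
  shows "independent_family K D max_localizations"
  unfolding independent_family_def max_localizations_eq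
proof (intro ballI impI)
  fix A B
  assume "A \<in> localization_at K D ` {M. maximalideal M R}" "B \<in> localization_at K D ` {M. maximalideal M R}"
    and "A \<noteq> B"
  then obtain M N where M: "maximalideal M R" "A = localization_at K D M"
    and N: "maximalideal N R" "B = localization_at K D N" and "M \<noteq> N"
    by auto
  have "Q = {\<zero>}" if Q: "Q \<in> sigma_spec K D A" "Q \<in> sigma_spec K D B" for Q
  proof (rule ccontr)
    assume "Q \<noteq> {\<zero>}"
    have "primeideal Q R" "Q \<subseteq> M" "Q \<subseteq> N"
      using localization.sigma_spec_localizationD[OF localizationI[OF M(1)]]
        localization.sigma_spec_localizationD[OF localizationI[OF N(1)]] Q M(2) N(2) by blast+
    \<comment> \<open>The dimension bound makes the nonzero prime \<open>Q\<close> maximal, so both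
      primes above it coincide with it.\<close>
    then have "M = Q" "N = Q"
      using maximalideal_eq[OF nonzero_prime_maximal[OF assms _ \<open>Q \<noteq> {\<zero>}\<close>]]
        maximalideal_imp_primeideal M(1) N(1) by blast+
    then show False
      using \<open>M \<noteq> N\<close> by simp
  qed
  moreover have "{\<zero>} \<in> sigma_spec K D A" "{\<zero>} \<in> sigma_spec K D B"
    using localization.zero_in_sigma_spec[OF localizationI] M N by simp_all
  ultimately show "sigma_spec K D A \<inter> sigma_spec K D B = {{\<zero>}}"
    by blast
qed

lemma compactin_max_localizations: "compactin (zariski_topology K D) max_localizations"
  unfolding compactin_def topspace_zariski max_localizations_eq
proof (intro conjI allI impI)
  show "localization_at K D ` {M. maximalideal M R} \<subseteq> overrings K D"
    using localization_mem_overrings by blast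
  fix \<U>
  assume "(\<forall>U\<in>\<U>. openin (zariski_topology K D) U) \<and> localization_at K D ` {M. maximalideal M R} \<subseteq> \<Union>\<U>"
  then have open_U: "\<And>U. U \<in> \<U> \<Longrightarrow> openin (zariski_topology K D) U"
    and cover: "\<And>M. maximalideal M R \<Longrightarrow> localization_at K D M \<in> \<Union>\<U>"
    by blast+
  \<comment> \<open>The maximal ideals avoiding \<open>d\<close> form a basic open set of the
    maximal spectrum; \<open>covers \<F> d\<close> says that the finite family \<open>\<F>\<close>
    takes care of the localizations over it.\<close>
  define covers where "covers \<F> d \<longleftrightarrow> finite \<F> \<and> \<F> \<subseteq> \<U> \<and>
    (\<forall>N. maximalideal N R \<longrightarrow> d \<notin> N \<longrightarrow> localization_at K D N \<in> \<Union>\<F>)" for \<F> d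
  let ?J = "{d \<in> D. \<exists>\<F>. covers \<F> d}"
  have "ideal ?J R"
    unfolding ideal_subring_iff[OF subring_D]
  proof (intro conjI ballI)
    have "\<zero> \<in> N" if "maximalideal N R" for N
      using ideal_imp_zero_mem maximalideal.axioms(1)[OF that] .
    then have "covers {} \<zero>"
      by (simp add: covers_def)
    then show "\<zero> \<in> ?J"
      by auto
    show "a \<oplus> b \<in> ?J" if ab: "a \<in> ?J" "b \<in> ?J" for a b
    proof -
      obtain \<F> \<G> where FG: "covers \<F> a" "covers \<G> b"
        using ab by blast
      \<comment> \<open>The basic open set of a sum lies in the union of those of its summands, so
        the two finite covers can be joined.\<close>
      have "a \<notin> N \<or> b \<notin> N" if "maximalideal N R" "a \<oplus> b \<notin> N" for N
        using iffD1[OF ideal_subring_iff[OF subring_D] maximalideal.axioms(1)[OF that(1)]] that(2)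
        by blast
      then have "covers (\<F> \<union> \<G>) (a \<oplus> b)"
        using FG unfolding covers_def by (metis UnCI Un_subset_iff Union_Un_distrib finite_UnI)
      then show ?thesis
        using ab by auto
    qed
    show "r \<otimes> a \<in> ?J" if ra: "r \<in> D" "a \<in> ?J" for r a
    proof -
      obtain \<F> where F: "covers \<F> a"
        using ra by blast
      have "a \<notin> N" if "maximalideal N R" "r \<otimes> a \<notin> N" for N
        using iffD1[OF ideal_subring_iff[OF subring_D] maximalideal.axioms(1)[OF that(1)]] that(2) ra(1)
        by blast
      then have "covers \<F> (r \<otimes> a)"
        using F unfolding covers_def by metis
      then show ?thesis
        using ra by auto
    qed
  qed blast
  then have "\<one> \<in> ?J"
  proof (rule one_mem_idealI)
    fix M assume M: "maximalideal M R"
    then obtain U where U: "U \<in> \<U>" "localization_at K D M \<in> U"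
      using cover by blast
    then obtain F where F: "finite F" "F \<subseteq> localization_at K D M" "{T \<in> overrings K D. F \<subseteq> T} \<subseteq> U"
      using openin_zariski_basis[OF open_U] by metis
    \<comment> \<open>The conditions in \<open>F\<close> persist at every maximal ideal avoiding
      their common denominator \<open>s\<close>, so the single set \<open>U\<close> covers all
      localizations over a neighbourhood of \<open>M\<close>.\<close>
    obtain s where s: "s \<in> D - M" "\<And>x. x \<in> F \<Longrightarrow> s \<otimes> x \<in> D"
      using localization.common_denominator[OF localizationI[OF M] F(1,2)] by metis
    have FK: "F \<subseteq> carrier K"
      using F(2) subringE(1)[OF localization.subring_localization[OF localizationI[OF M]]] by blast
    have "localization_at K D N \<in> U" if N: "maximalideal N R" "s \<notin> N" for N
    proof -
      have "F \<subseteq> localization_at K D N"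
        using localization.mem_localizationI[OF localizationI[OF N(1)]] FK s N(2) by blast
      then show ?thesis
        using F(3) localization_mem_overrings[OF N(1)] by blast
    qed
    then have "covers {U} s"
      using U(1) by (simp add: covers_def)
    then show "\<not> ?J \<subseteq> M"
      using s(1) by blast
  qed
  then obtain \<F> where "covers \<F> \<one>"
    by blast
  \<comment> \<open>No maximal ideal contains \<open>\<one>\<close>, so a cover belonging to
    \<open>\<one>\<close> covers the entire family.\<close>
  moreover have "\<one> \<notin> N" if "maximalideal N R" for N
    using localization.one_notin_P[OF localizationI[OF that]] .
  ultimately show "\<exists>\<F>. finite \<F> \<and> \<F> \<subseteq> \<U> \<and> localization_at K D ` {M. maximalideal M R} \<subseteq> \<Union>\<F>"
    unfolding covers_def by (intro exI[of _ \<F>]) blast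
qed

text \<open>If one localization is the whole field, then the zero ideal is maximal. Every maximal
  ideal contains it and hence equals it, so the family has a single member.\<close>

lemma max_localizations_quotient_field:
  assumes "carrier K \<in> max_localizations"
  shows "max_localizations = {carrier K}"
proof -
  obtain M where M: "maximalideal M R" "localization_at K D M = carrier K"
    using assms unfolding max_localizations_eq by auto
  then have "M = {\<zero>}"
    using localization.localization_eq_carrierD[OF localizationI] by blast
  then have "N = M" if "maximalideal N R" for N
    using maximalideal_eq[OF M(1) maximalideal_imp_primeideal[OF that]]
      ideal_imp_zero_mem[OF maximalideal.axioms(1)[OF that]] by simp
  then have "{M. maximalideal M R} = {M}"
    using M(1) by blast
  then show ?thesis
    unfolding max_localizations_eq using M(2) by simp
qed

end

theorem proposition8p1:
  fixes K :: "('a, 'b) ring_scheme" and D :: "'a set"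
  assumes "is_quotient_field K D"
    and "krull_dim (K\<lparr>carrier := D\<rparr>) = 1"
  shows "pre_jaffard_family TYPE('m) TYPE('n) K D
           {localization_at K D M | M. M \<in> max_spectrum (K\<lparr>carrier := D\<rparr>)}"
proof -
  interpret field_subring K D
  proof (intro field_subring.intro field_subring_axioms.intro)
    show "field K"
      using assms(1) by (simp add: is_quotient_field_def)
    show "subring D K"
      using assms(1) subcring.axioms(1)[OF subdomain.axioms(1), of D K]
      by (simp add: is_quotient_field_def)
  qed
  show ?thesis
    unfolding pre_jaffard_family_def
  proof (intro conjI ballI)
    show "max_localizations \<subseteq> overrings K D"
      unfolding max_localizations_eq using localization_mem_overrings by blast
    show "carrier K \<notin> max_localizations \<or> max_localizations = {carrier K}"
      using max_localizations_quotient_field by blast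
    show "flat_module TYPE('m) TYPE('n) R (subring_module K T)" if "T \<in> max_localizations" for T
      using that localization.flat_localization[OF localizationI] unfolding max_localizations_eq
      by blast
    show "independent_family K D max_localizations"
      using assms(2) by (intro independent_max_localizations) simp
  qed (fact complete_max_localizations compactin_max_localizations)+
qed

end
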